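(* Let $C$ be a row-finite $\omega\times\omega$ matrix over a field $\mathcal F$, let $f:\mathcal F^{(\omega)}\to\mathcal F^{(\omega)}$, $f(\xi)=\xi\cdot C$, be the linear mapping induced by $C$, let $G=(G_n)_{n\in\omega}$ be the matrix of rows produced by the Gaussian elimination part of the infinite Gauss-Jordan algorithm with rightmost pivots applied to $C$, and let $\mathbf G=(\mathbf g_n)_{n\in\omega}$ be the companion sequence obtained by applying the same row operations to the canonical basis. Let $J$ and $W$ be the sets of indices of nonzero and of zero rows of $G$, respectively. Then: (i) $\mathbf G$ is a basis of $\mathcal F^{(\omega)}$. (ii) $G\sim C$ (row equivalence). (iii) $\mathrm{RS}(G)=\mathrm{RS}(C)$. (iv) The set $\{G_j\}_{j\in J}$ of nonzero rows of $G$ is a complete basis of row-length of $\mathrm{RS}(C)$. (v) The set $\{\mathbf g_w\}_{w\in W}$ is a basis of $\mathrm{Ker}(f)$.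
   Context: $\omega=\{0,1,2,\dots\}$. $\mathcal F$ is a field and $\mathcal F^{(\omega)}$ is the space of sequences in $\mathcal F$ with finitely many nonzero terms, with canonical basis $(\mathbf e_i)_{i\in\omega}$. A row-finite $\omega\times\omega$ matrix is a sequence $C=(C_n)_{n\in\omega}$ of rows $C_n\in\mathcal F^{(\omega)}$; these matrices form an algebra under the usual matrix multiplication. $\mathrm{RS}(A)$ is the span of the rows of $A$. $A\sim B$ (row equivalent) means $Q\cdot A=B$ for some row-finite $Q$ having a two-sided row-finite inverse. For nonzero $x\in\mathcal F^{(\omega)}$ the length $\ell(x)$ is the largest index $i$ with $x_i\ne0$; $\ell(\mathbf 0)=-1$. For a set or family $X$ of vectors, $\mathfrak R(X)$ is the set of lengths of the nonzero members of $X$. A complete basis of row-length (= of rightmost index) of a subspace $\mathcal Z$ of $\mathcal F^{(\omega)}$ is a Hamel basis $\mathbf F$ of $\mathcal Z$ with $\mathfrak R(\mathbf F)=\mathfrak R(\mathcal Z)$. Infinite Gauss-Jordan algorithm with rightmost pivots applied to $C$. It produces vectors $L^{(i)}_n\in\mathcal F^{(\omega)}$ (entries $l^{(i)}_{nj}$) for $n\in\omega$, $i\ge -1$, and $G_n=L^{(n)}_n$, stage by stage for $n=0,1,2,\dots$. Stage $n$ uses the vectors $L^{(n-1)}_0,\dots,L^{(n-1)}_{n-1}$ of the previous stage: (1) Gaussian elimination: $L^{(-1)}_n=C_n$; for $i=0,1,\dots,n-1$ in this order, $L^{(i)}_n=L^{(i-1)}_n-l^{(i-1)}_{n\rho_i}L^{(n-1)}_i$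 with $\rho_i=\ell(L^{(n-1)}_i)$ if $L^{(n-1)}_i\ne\mathbf 0$, and $L^{(i)}_n=L^{(i-1)}_n$ if $L^{(n-1)}_i=\mathbf 0$. (2) Normalization: $L^{(n)}_n=G_n$, where $G_n$ is $L^{(n-1)}_n$ divided by its rightmost nonzero entry if $L^{(n-1)}_n\neq\mathbf 0$, and $G_n=\mathbf 0$ otherwise. (3) Jordan elimination: for $0\le i\le n-1$, $L^{(n)}_i=L^{(n-1)}_i-l^{(n-1)}_{i\rho_n}G_n$ with $\rho_n=\ell(G_n)$ if $G_n\neq\mathbf 0$, and $L^{(n)}_i=L^{(n-1)}_i$ if $G_n=\mathbf 0$. Companion vectors: let $E^{(-1)}_n=\mathbf e_n$ and define $E^{(i)}_n$ by performing on the $E$'s exactly the same operations with the same scalars (determined by the $L$'s) as those performed on the $L$'s: $E^{(i)}_n=E^{(i-1)}_n-l^{(i-1)}_{n\rho_i}E^{(n-1)}_i$ in (1) if $L^{(n-1)}_i\neq\mathbf 0$ (otherwise unchanged); in (2), $E^{(n)}_n$ is $E^{(n-1)}_n$ divided by the rightmost nonzero entry of $L^{(n-1)}_n$ if $L^{(n-1)}_n\ne\mathbf 0$, and $E^{(n)}_n=E^{(n-1)}_n$ otherwise; in (3), $E^{(n)}_i=E^{(n-1)}_i-l^{(n-1)}_{i\rho_n}E^{(n)}_n$ if $G_n\ne\mathbf 0$ (otherwise unchanged). Put $\mathbf g_n=E^{(n)}_n$. *)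

theory Defs
  imports Complex_Main "HOL-Library.Poly_Mapping"
begin

text \<open>
  The space of finitely supported sequences over a field is \<^typ>\<open>nat \<Rightarrow>\<^sub>0 'a::field\<close>; the
  canonical basis vector with index \<open>n\<close> is \<open>Poly_Mapping.single n 1\<close>.
\<close>

type_synonym 'a fseq = "nat \<Rightarrow>\<^sub>0 'a"

text \<open>Row-finiteness is enforced by the type of the rows.\<close>

type_synonym 'a rfmat = "nat \<Rightarrow> 'a fseq"

definition fscale :: "'a::field \<Rightarrow> 'a fseq \<Rightarrow> 'a fseq" (infixr \<open>*\<^sub>f\<close> 75)
  where "c *\<^sub>f x = Poly_Mapping.map ((*) c) x"

lemma lookup_fscale [simp]: "Poly_Mapping.lookup (c *\<^sub>f x) i = c * Poly_Mapping.lookup x i"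
  by (simp add: fscale_def Poly_Mapping.map.rep_eq when_def)

global_interpretation fsv: vector_space "fscale :: 'a::field \<Rightarrow> 'a fseq \<Rightarrow> 'a fseq"
  by unfold_locales (auto intro!: poly_mapping_eqI simp: lookup_add algebra_simps)

definition vec_mat :: "'a::field fseq \<Rightarrow> 'a rfmat \<Rightarrow> 'a fseq" (infixl \<open>v*\<close> 70)
  where "x v* A = (\<Sum>k\<in>Poly_Mapping.keys x. Poly_Mapping.lookup x k *\<^sub>f A k)"

lemma lookup_vec_mat:
  "Poly_Mapping.lookup (x v* A) j =
    (\<Sum>k\<in>Poly_Mapping.keys x. Poly_Mapping.lookup x k * Poly_Mapping.lookup (A k) j)"
  by (simp add: vec_mat_def Poly_Mapping.lookup_sum)

definition mat_mult :: "'a::field rfmat \<Rightarrow> 'a rfmat \<Rightarrow> 'a rfmat" (infixl \<open>m*\<close> 70)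
  where "A m* B = (\<lambda>n. A n v* B)"

definition mat_id :: "'a::field rfmat"
  where "mat_id = (\<lambda>n. Poly_Mapping.single n 1)"

definition row_equiv :: "'a::field rfmat \<Rightarrow> 'a rfmat \<Rightarrow> bool" (infix \<open>\<sim>\<^sub>r\<close> 50)
  where "A \<sim>\<^sub>r B \<longleftrightarrow> (\<exists>Q. (\<exists>Q'. Q m* Q' = mat_id \<and> Q' m* Q = mat_id) \<and> Q m* A = B)"

definition row_space :: "'a::field rfmat \<Rightarrow> 'a fseq set"
  where "row_space A = fsv.span (range A)"

definition fseq_kernel :: "('a::field fseq \<Rightarrow> 'a fseq) \<Rightarrow> 'a fseq set"
  where "fseq_kernel f = {x. f x = 0}"

text \<open>The length is the largest index of a nonzero entry, not the number of entries.\<close>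

definition len :: "'a::field fseq \<Rightarrow> int"
  where "len x = (if x = 0 then -1 else int (Max (Poly_Mapping.keys x)))"

definition lengths :: "'a::field fseq set \<Rightarrow> int set"
  where "lengths X = len ` (X - {0})"

definition hamel_basis :: "'a::field fseq set \<Rightarrow> 'a fseq set \<Rightarrow> bool"
  where "hamel_basis B Z \<longleftrightarrow> fsv.independent B \<and> fsv.span B = Z"

definition complete_length_basis :: "'a::field fseq set \<Rightarrow> 'a fseq set \<Rightarrow> bool"
  where "complete_length_basis B Z \<longleftrightarrow> hamel_basis B Z \<and> lengths B = lengths Z"

text \<open>
  Superscripts of the algorithm start at \<open>-1\<close> and are shifted by one:
  \<open>gj_row C (Suc i) n\<close> is \<open>L\<^sup>(\<^sup>i\<^sup>)\<close> with lower index \<open>n\<close>, and \<open>gj_row C 0 n\<close> is \<open>C n\<close>.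
  The three cases of the recursion are Gaussian elimination (\<open>i < n\<close>, during stage \<open>n\<close>),
  normalization (\<open>i = n\<close>), and Jordan elimination (\<open>i > n\<close>, during stage \<open>i\<close>). In the first case
  \<open>gj_row C n i\<close> is row \<open>i\<close> at the end of stage \<open>n - 1\<close>; in the third case \<open>gj_row C (Suc i) i\<close>
  is the row normalized in stage \<open>i\<close>. Termination follows the order of execution: by stage, then
  elimination before Jordan elimination, then superscript.
\<close>

function gj_row :: "'a::field rfmat \<Rightarrow> nat \<Rightarrow> nat \<Rightarrow> 'a fseq" where
  "gj_row C 0 n = C n"
| "gj_row C (Suc i) n =
    (if i < n then
       (let x = gj_row C i n; p = gj_row C n i in
        if p \<noteq> 0 then x - Poly_Mapping.lookup x (nat (len p)) *\<^sub>f p else x)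
     else if i = n then
       (let x = gj_row C n n in
        if x \<noteq> 0 then inverse (Poly_Mapping.lookup x (nat (len x))) *\<^sub>f x else 0)
     else
       (let x = gj_row C i n; p = gj_row C (Suc i) i in
        if p \<noteq> 0 then x - Poly_Mapping.lookup x (nat (len p)) *\<^sub>f p else x))"
  by pat_completeness auto
termination
  by (relation "measures [\<lambda>(C, k, n). max (k - 1) n, \<lambda>(C, k, n). if k \<le> Suc n then 0 else 1,
    \<lambda>(C, k, n). k]") auto

text \<open>
  The companion vectors, with the same shift of the superscript; all scalars and case distinctions
  come from \<^const>\<open>gj_row\<close>.
\<close>

function gj_comp :: "'a::field rfmat \<Rightarrow> nat \<Rightarrow> nat \<Rightarrow> 'a fseq" where
  "gj_comp C 0 n = Poly_Mapping.single n 1"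
| "gj_comp C (Suc i) n =
    (if i < n then
       (let x = gj_row C i n; p = gj_row C n i in
        if p \<noteq> 0
        then gj_comp C i n - Poly_Mapping.lookup x (nat (len p)) *\<^sub>f gj_comp C n i
        else gj_comp C i n)
     else if i = n then
       (let x = gj_row C n n in
        if x \<noteq> 0
        then inverse (Poly_Mapping.lookup x (nat (len x))) *\<^sub>f gj_comp C n n
        else gj_comp C n n)
     else
       (let x = gj_row C i n; p = gj_row C (Suc i) i in
        if p \<noteq> 0
        then gj_comp C i n - Poly_Mapping.lookup x (nat (len p)) *\<^sub>f gj_comp C (Suc i) i
        else gj_comp C i n))"
  by pat_completeness auto
termination
  by (relation "measures [\<lambda>(C, k, n). max (k - 1) n, \<lambda>(C, k, n). if k \<le> Suc n then 0 else 1,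
    \<lambda>(C, k, n). k]") auto

definition gauss_mat :: "'a::field rfmat \<Rightarrow> 'a rfmat"
  where "gauss_mat C = (\<lambda>n. gj_row C (Suc n) n)"

definition comp_seq :: "'a::field rfmat \<Rightarrow> nat \<Rightarrow> 'a fseq"
  where "comp_seq C = (\<lambda>n. gj_comp C (Suc n) n)"

end

theory Submission
  imports Defs
begin

text \<open>
  Everything rests on lengths. A family of nonzero vectors with pairwise distinct lengths is
  independent, because the longest vector of a linear combination cannot be cancelled; for the same
  reason every nonzero vector of the span has the length of a member of the family. Conversely a
  part of a subspace that realizes all lengths of the subspace spans it, by descent on the length
  (\<open>span_eq_if_lengths_subset\<close>).

  For the companion vectors, up to the normalization of row \<open>n\<close> the row operations only add to
  it vectors supported below index \<open>n\<close>, and the scalar used in the normalization is nonzero, so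
  \<open>comp_seq C n\<close> has length exactly \<open>n\<close> (\<open>len_comp_seq\<close>). Hence these vectors form a basis, which means that the matrix \<open>P\<close> with
  these rows is invertible. Row operations commute with \<open>\<xi> \<mapsto> \<xi> v* C\<close>, so \<open>P m* C = gauss_mat C\<close>.
  Row equivalence and equality of the row spaces follow.

  For the rows of \<open>gauss_mat C\<close>, the invariant is that after each stage the rows treated so far are
  reduced: every pivot is 1 and is their only nonzero entry in its column (\<open>reduced_gj_row\<close>). Elimination clears a new row
  at all earlier pivots, so its own pivot is new. Jordan elimination then does not move the earlier
  pivots: a longer new row has coefficient zero, and a shorter one does not reach the old pivot.
  Thus each row keeps the length that it had when it was normalized, and the nonzero rows of
  \<open>gauss_mat C\<close> have distinct lengths
  (\<open>gauss_mat_distinct_lengths\<close>). This gives the complete basis of the row space. Finally, a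
  vector \<open>y v* P\<close> is in the kernel iff \<open>y v* gauss_mat C = 0\<close>, and by independence of
  the nonzero rows this says that \<open>y\<close> is supported on the indices of zero rows.
\<close>

section \<open>Vectors with distinct lengths\<close>

abbreviation lookup :: "'a::zero fseq \<Rightarrow> nat \<Rightarrow> 'a"
  where "lookup \<equiv> Poly_Mapping.lookup"

abbreviation keys :: "'a::zero fseq \<Rightarrow> nat set"
  where "keys \<equiv> Poly_Mapping.keys"

abbreviation piv :: "'a::field fseq \<Rightarrow> nat"
  where "piv x \<equiv> nat (len x)"

lemma int_piv: "x \<noteq> 0 \<Longrightarrow> int (piv x) = len x"
  by (simp add: len_def)

lemma lookup_piv_nonzero:
  assumes "x \<noteq> 0"
  shows "lookup x (piv x) \<noteq> 0"
proof -
  have "Max (keys x) \<in> keys x"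
    using assms by (intro Max_in) auto
  then show ?thesis
    using assms by (simp add: len_def in_keys_iff)
qed

lemma lookup_beyond_piv:
  assumes "piv x < m"
  shows "lookup x m = 0"
proof (rule ccontr)
  assume *: "lookup x m \<noteq> 0"
  then have "x \<noteq> 0" and "m \<in> keys x"
    by (auto simp: in_keys_iff)
  then show False
    using assms by (auto simp: len_def)
qed

lemma len_eqI:
  assumes "lookup x m \<noteq> 0" and "\<And>k. m < k \<Longrightarrow> lookup x k = 0"
  shows "len x = int m"
proof -
  have "x \<noteq> 0"
    using assms(1) by auto
  moreover have "Max (keys x) = m"
    using assms by (intro Max_eqI) (auto simp: in_keys_iff intro: leI)
  ultimately show ?thesis
    by (simp add: len_def)
qed

lemma len_lt_if_lookup_zero:
  assumes "x \<noteq> 0" and "\<And>k. m \<le> k \<Longrightarrow> lookup x k = 0"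
  shows "piv x < m"
  using assms lookup_piv_nonzero[of x] by (meson not_le)

text \<open>The longest term is alone in contributing to its own pivot column.\<close>

lemma len_combination_distinct_lengths:
  fixes v :: "'i \<Rightarrow> 'a::field fseq"
  assumes "finite S" and "S \<noteq> {}"
    and v: "\<And>i. i \<in> S \<Longrightarrow> v i \<noteq> 0" and c: "\<And>i. i \<in> S \<Longrightarrow> c i \<noteq> 0"
    and inj: "inj_on (\<lambda>i. len (v i)) S"
  shows "(\<Sum>i\<in>S. c i *\<^sub>f v i) \<noteq> 0 \<and> (\<exists>i\<in>S. len (\<Sum>i\<in>S. c i *\<^sub>f v i) = len (v i))"
proof -
  have "Max ((\<lambda>i. piv (v i)) ` S) \<in> (\<lambda>i. piv (v i)) ` S"
    using assms(1,2) by (intro Max_in) auto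
  then obtain m where m: "m \<in> S" and max: "piv (v m) = Max ((\<lambda>i. piv (v i)) ` S)"
    by auto
  have le: "piv (v i) \<le> piv (v m)" if "i \<in> S" for i
    using that assms(1) by (simp add: max)
  have lt: "piv (v i) < piv (v m)" if "i \<in> S" "i \<noteq> m" for i
  proof -
    have "len (v i) \<noteq> len (v m)"
      using inj that m unfolding inj_on_def by blast
    then show ?thesis
      using le[OF that(1)] int_piv[OF v[OF that(1)]] int_piv[OF v[OF m]]
      by (metis le_neq_implies_less)
  qed
  let ?s = "\<Sum>i\<in>S. c i *\<^sub>f v i"
  have "lookup ?s (piv (v m)) = (\<Sum>i\<in>S. if i = m then c m * lookup (v m) (piv (v m)) else 0)"
    unfolding lookup_sum by (rule sum.cong) (auto simp: lookup_beyond_piv[OF lt])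
  also have "\<dots> = c m * lookup (v m) (piv (v m))"
    using assms(1) m by simp
  finally have nz: "lookup ?s (piv (v m)) \<noteq> 0"
    using c[OF m] lookup_piv_nonzero[OF v[OF m]] by simp
  have "lookup ?s k = 0" if "piv (v m) < k" for k
  proof -
    have "lookup (v i) k = 0" if "i \<in> S" for i
      using le[OF that] \<open>piv (v m) < k\<close> by (intro lookup_beyond_piv) simp
    then show ?thesis
      by (simp add: lookup_sum)
  qed
  then have "len ?s = len (v m)"
    using len_eqI[OF nz] int_piv[OF v[OF m]] by simp
  moreover have "?s \<noteq> 0"
    using nz by auto
  ultimately show ?thesis
    using m by blast
qed

lemma len_combination_subset:
  assumes "0 \<notin> B" and "inj_on len B" and U: "finite U" "U \<subseteq> B" and "\<exists>v\<in>U. r v \<noteq> 0"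
  shows "(\<Sum>v\<in>U. r v *\<^sub>f v) \<noteq> 0 \<and> len (\<Sum>v\<in>U. r v *\<^sub>f v) \<in> len ` B"
proof -
  let ?S = "{v\<in>U. r v \<noteq> 0}"
  have eq: "(\<Sum>v\<in>U. r v *\<^sub>f v) = (\<Sum>v\<in>?S. r v *\<^sub>f v)"
    using U(1) by (intro sum.mono_neutral_right) auto
  have inj: "inj_on (\<lambda>v. len v) ?S"
    by (rule inj_on_subset[OF assms(2)]) (use U(2) in blast)
  have "(\<Sum>v\<in>?S. r v *\<^sub>f v) \<noteq> 0 \<and> (\<exists>v\<in>?S. len (\<Sum>v\<in>?S. r v *\<^sub>f v) = len v)"
    by (rule len_combination_distinct_lengths[OF _ _ _ _ inj]) (use assms in auto)
  then show ?thesis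
    unfolding eq using U(2) by blast
qed

lemma independent_if_distinct_lengths:
  assumes "0 \<notin> B" and "inj_on len B"
  shows "fsv.independent B"
proof
  assume "fsv.dependent B"
  then obtain U r where U: "finite U" "U \<subseteq> B" and zero: "(\<Sum>v\<in>U. r v *\<^sub>f v) = 0"
    and nz: "\<exists>v\<in>U. r v \<noteq> 0"
    unfolding fsv.dependent_explicit by (elim exE conjE) (rule that)
  then show False
    using len_combination_subset[OF assms U nz] by simp
qed

lemma lengths_span_distinct_lengths:
  assumes "0 \<notin> B" and "inj_on len B"
  shows "lengths (fsv.span B) = lengths B"
proof
  show "lengths B \<subseteq> lengths (fsv.span B)"
    unfolding lengths_def using fsv.span_superset by blast
  show "lengths (fsv.span B) \<subseteq> lengths B"
  proof
    fix l assume "l \<in> lengths (fsv.span B)"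
    then obtain x where x: "x \<in> fsv.span B" "x \<noteq> 0" "l = len x"
      by (auto simp: lengths_def)
    from x(1) obtain U r where U: "finite U" "U \<subseteq> B" and eq: "x = (\<Sum>v\<in>U. r v *\<^sub>f v)"
      unfolding fsv.span_explicit by blast
    have "x = 0" if "\<forall>v\<in>U. r v = 0"
      unfolding eq using that by (intro sum.neutral) simp
    then have "\<exists>v\<in>U. r v \<noteq> 0"
      using x(2) by blast
    then have "len x \<in> len ` B"
      using len_combination_subset[OF assms U, of r] by (simp only: eq simp_thms)
    then show "l \<in> lengths B"
      using assms(1) x(3) by (auto simp: lengths_def)
  qed
qed

text \<open>Subtracting a multiple of a member of the same length makes a vector shorter.\<close>

lemma span_eq_if_lengths_subset:
  assumes "fsv.subspace Z" and "B \<subseteq> Z" and "lengths Z \<subseteq> lengths B"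
  shows "fsv.span B = Z"
proof
  show "fsv.span B \<subseteq> Z"
    using assms(1,2) by (simp add: fsv.span_minimal)
  have "z \<in> Z \<Longrightarrow> z \<in> fsv.span B" for z
  proof (induction "piv z" arbitrary: z rule: less_induct)
    case less
    show ?case
    proof (cases "z = 0")
      case True
      then show ?thesis by (simp add: fsv.span_zero)
    next
      case False
      then have "len z \<in> lengths B"
        using less.prems assms(3) by (auto simp: lengths_def)
      then obtain b where b: "b \<in> B" "b \<noteq> 0" "len z = len b"
        unfolding lengths_def by blast
      define c where "c = lookup z (piv z) / lookup b (piv z)"
      define y where "y = z - c *\<^sub>f b"
      have b_nz: "lookup b (piv z) \<noteq> 0"
        using lookup_piv_nonzero[OF b(2)] b(3) by simp
      have y_beyond: "lookup y k = 0" if "piv z \<le> k" for k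
        using that b_nz b(3) lookup_beyond_piv[of z k] lookup_beyond_piv[of b k]
        by (cases "k = piv z") (auto simp: y_def c_def lookup_minus)
      have "y \<in> Z"
        using less.prems b(1) assms(1,2)
        by (auto simp: y_def intro!: fsv.subspace_diff fsv.subspace_scale)
      then have "y \<in> fsv.span B"
        using less.hyps[of y] len_lt_if_lookup_zero[of y "piv z"] y_beyond
        by (cases "y = 0") (auto simp: fsv.span_zero)
      moreover have "c *\<^sub>f b \<in> fsv.span B"
        using b(1) by (simp add: fsv.span_base fsv.span_scale)
      ultimately have "y + c *\<^sub>f b \<in> fsv.span B"
        by (rule fsv.span_add)
      then show ?thesis
        by (simp add: y_def)
    qed
  qed
  then show "Z \<subseteq> fsv.span B" by blast
qed

section \<open>Row-finite matrices\<close>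

lemma vec_mat_superset:
  assumes "finite S" and "keys x \<subseteq> S"
  shows "x v* A = (\<Sum>k\<in>S. lookup x k *\<^sub>f A k)"
  unfolding vec_mat_def using assms
  by (intro sum.mono_neutral_left) (auto simp: in_keys_iff)

lemma vec_mat_zero [simp]: "0 v* A = 0"
  by (simp add: vec_mat_def)

lemma vec_mat_scale [simp]: "(c *\<^sub>f x) v* A = c *\<^sub>f (x v* A)"
proof -
  have "keys (c *\<^sub>f x) \<subseteq> keys x"
    by (auto simp: in_keys_iff)
  then have "(c *\<^sub>f x) v* A = (\<Sum>k\<in>keys x. lookup (c *\<^sub>f x) k *\<^sub>f A k)"
    by (intro vec_mat_superset) auto
  then show ?thesis
    by (simp add: vec_mat_def fsv.scale_sum_right)
qed

lemma vec_mat_add [simp]: "(x + y) v* A = x v* A + y v* A"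
proof -
  let ?S = "keys x \<union> keys y"
  have "(x + y) v* A = (\<Sum>k\<in>?S. lookup (x + y) k *\<^sub>f A k)"
    by (intro vec_mat_superset keys_add) auto
  moreover have "x v* A = (\<Sum>k\<in>?S. lookup x k *\<^sub>f A k)"
    by (intro vec_mat_superset) auto
  moreover have "y v* A = (\<Sum>k\<in>?S. lookup y k *\<^sub>f A k)"
    by (intro vec_mat_superset) auto
  ultimately show ?thesis
    by (simp add: lookup_add fsv.scale_left_distrib sum.distrib)
qed

lemma vec_mat_diff [simp]: "(x - y) v* A = x v* A - y v* A"
  using vec_mat_add[of "x - y" y A] by (simp add: algebra_simps del: vec_mat_add)

lemma vec_mat_sum: "(\<Sum>i\<in>S. h i) v* A = (\<Sum>i\<in>S. h i v* A)"
  by (induction S rule: infinite_finite_induct) auto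

lemma vec_mat_single [simp]: "Poly_Mapping.single n 1 v* A = A n"
  by (simp add: vec_mat_def)

lemma vec_mat_id [simp]: "x v* mat_id = x"
  by (rule poly_mapping_eqI)
    (simp add: lookup_vec_mat mat_id_def lookup_single when_def in_keys_iff
      if_distrib[of "(*) _"] cong: if_cong)

lemma vec_mat_assoc: "(x v* A) v* B = x v* (A m* B)"
  by (simp add: vec_mat_def[of x] vec_mat_sum mat_mult_def)

lemma mat_mult_assoc: "(A m* B) m* D = A m* (B m* D)"
  by (rule ext) (simp add: mat_mult_def vec_mat_assoc)

lemma mat_id_mult [simp]: "mat_id m* A = A"
  by (rule ext) (simp add: mat_mult_def mat_id_def)

lemma span_image_eq_vec_mat:
  "fsv.span (A ` I) = {x v* A |x. keys x \<subseteq> I}"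
proof
  have "fsv.subspace {x v* A |x. keys x \<subseteq> I}"
    unfolding fsv.subspace_def
  proof (intro conjI ballI allI)
    show "0 \<in> {x v* A |x. keys x \<subseteq> I}"
      by (auto intro!: exI[of _ 0])
  next
    fix u v assume "u \<in> {x v* A |x. keys x \<subseteq> I}" "v \<in> {x v* A |x. keys x \<subseteq> I}"
    then obtain x y where "u = x v* A" "v = y v* A" "keys x \<subseteq> I" "keys y \<subseteq> I"
      by blast
    moreover from this have "keys (x + y) \<subseteq> I"
      using keys_add[of x y] by blast
    ultimately show "u + v \<in> {x v* A |x. keys x \<subseteq> I}"
      by (auto intro!: exI[of _ "x + y"])
  next
    fix c u assume "u \<in> {x v* A |x. keys x \<subseteq> I}"
    then obtain x where "u = x v* A" "keys x \<subseteq> I"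
      by blast
    then show "c *\<^sub>f u \<in> {x v* A |x. keys x \<subseteq> I}"
      by (auto intro!: exI[of _ "c *\<^sub>f x"] simp: in_keys_iff subset_iff)
  qed
  moreover have "A ` I \<subseteq> {x v* A |x. keys x \<subseteq> I}"
  proof safe
    fix i assume "i \<in> I"
    then show "\<exists>x. A i = x v* A \<and> keys x \<subseteq> I"
      by (intro exI[of _ "Poly_Mapping.single i 1"]) auto
  qed
  ultimately show "fsv.span (A ` I) \<subseteq> {x v* A |x. keys x \<subseteq> I}"
    by (rule fsv.span_minimal[rotated])
  show "{x v* A |x. keys x \<subseteq> I} \<subseteq> fsv.span (A ` I)"
    by (auto simp: vec_mat_def intro!: fsv.span_sum fsv.span_scale intro: fsv.span_base)
qed

lemma row_space_eq_range: "row_space A = range (\<lambda>x. x v* A)"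
  using span_image_eq_vec_mat[of A UNIV] by (auto simp: row_space_def)

text \<open>
  Lifting the unit vectors through \<open>x \<mapsto> x v* A\<close> gives a left inverse; injectivity makes it
  a right inverse.
\<close>

lemma mat_invertible_if_bij:
  assumes inj: "\<And>x. x v* A = 0 \<Longrightarrow> x = 0" and surj: "row_space A = UNIV"
  obtains Q where "Q m* A = mat_id" and "A m* Q = mat_id"
proof -
  have "\<exists>q. q v* A = mat_id n" for n
    using surj unfolding row_space_eq_range by (metis UNIV_I imageE)
  then obtain Q where Q: "\<And>n. Q n v* A = mat_id n"
    by metis
  have left: "Q m* A = mat_id"
    by (rule ext) (simp add: mat_mult_def Q)
  have "A m* Q = mat_id"
  proof
    fix n
    have "(A m* Q) n v* A = A n"
      by (simp add: mat_mult_def vec_mat_assoc) (simp add: left flip: mat_mult_def)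
    then have "((A m* Q) n - mat_id n) v* A = 0"
      by (simp add: mat_id_def)
    then show "(A m* Q) n = mat_id n"
      using inj by fastforce
  qed
  with left show ?thesis by (rule that)
qed

text \<open>
  This turns a kernel condition into one on supports. For a matrix without zero rows it says that
  \<open>x \<mapsto> x v* A\<close> is injective.
\<close>

lemma vec_mat_eq_0_distinct_lengths:
  assumes inj: "inj_on (\<lambda>n. len (A n)) {n. A n \<noteq> 0}" and "x v* A = 0"
  shows "keys x \<subseteq> {n. A n = 0}"
proof (rule ccontr)
  let ?S = "keys x \<inter> {n. A n \<noteq> 0}"
  assume "\<not> keys x \<subseteq> {n. A n = 0}"
  then have ne: "?S \<noteq> {}"
    by blast
  have inj': "inj_on (\<lambda>n. len (A n)) ?S"
    by (rule inj_on_subset[OF inj]) blast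
  have "(\<Sum>k\<in>?S. lookup x k *\<^sub>f A k) \<noteq> 0"
    by (rule conjunct1[OF len_combination_distinct_lengths[OF _ ne _ _ inj']])
      (auto simp: in_keys_iff)
  moreover have "x v* A = (\<Sum>k\<in>?S. lookup x k *\<^sub>f A k)"
    unfolding vec_mat_def by (intro sum.mono_neutral_right) auto
  ultimately show False
    using assms(2) by simp
qed

section \<open>The companion vectors\<close>

declare gj_row.simps [simp del] gj_comp.simps [simp del]

lemma gj_comp_vec_mat: "gj_comp C k n v* C = gj_row C k n"
proof (induction C k n rule: gj_comp.induct)
  case (1 C n)
  then show ?case by (simp add: gj_comp.simps gj_row.simps)
next
  case (2 C i n)
  then show ?case
    by (simp add: gj_comp.simps(2)[of C i n] gj_row.simps(2)[of C i n] Let_def)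
qed

lemma comp_seq_mult: "comp_seq C m* C = gauss_mat C"
  by (rule ext) (simp add: mat_mult_def comp_seq_def gauss_mat_def gj_comp_vec_mat)

text \<open>
  Up to its normalization row \<open>n\<close> is combined with earlier rows only; from then on, Jordan
  elimination brings in one new row per stage, and the rows \<open>0, \<dots>, k - 1\<close> are all that has
  been used at the end of stage \<open>k - 1\<close>.
\<close>

lemma lookup_gj_comp_beyond: "max k (Suc n) \<le> m \<Longrightarrow> lookup (gj_comp C k n) m = 0"
proof (induction C k n rule: gj_comp.induct)
  case (1 C n)
  then show ?case by (simp add: gj_comp.simps lookup_single)
next
  case (2 C i n)
  then show ?case
    by (cases i n rule: linorder_cases)
      (simp_all add: gj_comp.simps(2)[of C i n] gj_comp.simps(2)[of C n n] Let_def lookup_minus)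
qed

text \<open>
  The companions subtracted during elimination are those of rows \<open>i < n\<close> at the end of stage
  \<open>n - 1\<close>, and these vanish at index \<open>n\<close>.
\<close>

lemma lookup_gj_comp_diag: "k \<le> n \<Longrightarrow> lookup (gj_comp C k n) n = 1"
  by (induction k)
    (simp_all add: gj_comp.simps Let_def lookup_minus lookup_gj_comp_beyond)

lemma len_comp_seq: "len (comp_seq C n) = int n"
proof (rule len_eqI)
  show "lookup (comp_seq C n) n \<noteq> 0"
    by (simp add: comp_seq_def gj_comp.simps Let_def lookup_gj_comp_diag lookup_piv_nonzero)
  show "lookup (comp_seq C n) k = 0" if "n < k" for k
    using that by (simp add: comp_seq_def lookup_gj_comp_beyond)
qed

lemma comp_seq_nonzero: "comp_seq C n \<noteq> 0"
  using len_comp_seq[of C n] by (auto simp: len_def)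

lemma inj_comp_seq: "inj (comp_seq C)"
  by (rule injI) (metis len_comp_seq of_nat_eq_iff)

lemma hamel_basis_comp_seq:
  fixes C :: "'a::field rfmat"
  shows "hamel_basis (range (comp_seq C)) UNIV"
  unfolding hamel_basis_def
proof
  show "fsv.independent (range (comp_seq C))"
    by (rule independent_if_distinct_lengths)
      (auto simp: comp_seq_nonzero len_comp_seq inj_on_def dest: sym)
  have "lengths (UNIV :: 'a fseq set) \<subseteq> lengths (range (comp_seq C))"
  proof
    fix l assume "l \<in> lengths (UNIV :: 'a fseq set)"
    then obtain x :: "'a fseq" where "x \<noteq> 0" "l = len x"
      by (auto simp: lengths_def)
    then have "l = len (comp_seq C (piv x))"
      by (simp only: len_comp_seq int_piv not_False_eq_True)
    then show "l \<in> lengths (range (comp_seq C))"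
      by (auto simp: lengths_def comp_seq_nonzero)
  qed
  then show "fsv.span (range (comp_seq C)) = UNIV"
    by (intro span_eq_if_lengths_subset) auto
qed

lemma comp_seq_invertible:
  obtains Q where "Q m* comp_seq C = mat_id" and "comp_seq C m* Q = mat_id"
proof (rule mat_invertible_if_bij[of "comp_seq C"])
  fix x assume "x v* comp_seq C = 0"
  then have "keys x \<subseteq> {n. comp_seq C n = 0}"
    by (intro vec_mat_eq_0_distinct_lengths) (auto simp: len_comp_seq inj_on_def)
  then show "x = 0"
    by (simp add: comp_seq_nonzero)
next
  show "row_space (comp_seq C) = UNIV"
    using hamel_basis_comp_seq by (auto simp: row_space_def hamel_basis_def)
qed (use that in auto)

section \<open>The reduced rows\<close>

text \<open>
  Reduced echelon form of the first \<open>k\<close> rows with rightmost pivots, where the pivots may come in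
  any order and zero rows may stand anywhere.
\<close>

definition reduced :: "nat \<Rightarrow> 'a::field rfmat \<Rightarrow> bool"
  where "reduced k R \<longleftrightarrow> (\<forall>i<k. R i \<noteq> 0 \<longrightarrow>
    (\<forall>j<k. lookup (R j) (piv (R i)) = (if j = i then 1 else 0)))"

lemma reducedD:
  "reduced k R \<Longrightarrow> i < k \<Longrightarrow> j < k \<Longrightarrow> R i \<noteq> 0 \<Longrightarrow>
    lookup (R j) (piv (R i)) = (if j = i then 1 else 0)"
  unfolding reduced_def by blast

text \<open>
  The column of an earlier pivot, once cleared, stays clear, since the rows subtracted later vanish
  there.
\<close>

lemma elimination_clears_pivots:
  assumes red: "reduced n (gj_row C n)" and "i \<le> n" and "j < i" and "gj_row C n j \<noteq> 0"
  shows "lookup (gj_row C i n) (piv (gj_row C n j)) = 0"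
  using assms(2,3)
proof (induction i)
  case 0
  then show ?case by simp
next
  case (Suc i)
  then show ?case
    using reducedD[OF red, of j i] reducedD[OF red, of j j] assms(4)
    by (cases "j = i") (auto simp: gj_row.simps(2)[of C i n] Let_def lookup_minus)
qed

text \<open>
  This is the step of Jordan elimination on a row \<open>x\<close>: a longer \<open>y\<close> is subtracted with
  coefficient zero, a shorter one leaves the pivot of \<open>x\<close> alone, and equal length is excluded.
\<close>

lemma jordan_step_keeps_len:
  assumes "x \<noteq> 0" and "y \<noteq> 0" and "lookup y (piv x) = 0"
  shows "len (x - lookup x (piv y) *\<^sub>f y) = len x"
proof -
  have "piv y \<noteq> piv x"
    using assms(2,3) lookup_piv_nonzero by metis
  then consider "piv x < piv y" | "piv y < piv x"
    by linarith
  then show ?thesis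
  proof cases
    case 1
    then show ?thesis by (simp add: lookup_beyond_piv)
  next
    case 2
    then have "len (x - lookup x (piv y) *\<^sub>f y) = int (piv x)"
      using assms lookup_piv_nonzero[of x]
      by (intro len_eqI) (auto simp: lookup_minus lookup_beyond_piv)
    then show ?thesis
      by (simp only: int_piv[OF assms(1)])
  qed
qed

lemma len_eq_imp_zero_iff: "len x = len y \<Longrightarrow> x = 0 \<longleftrightarrow> y = 0"
  by (auto simp: len_def split: if_splits)

lemma stage_keeps_len:
  assumes "reduced n (gj_row C n)" and "i < n"
  shows "len (gj_row C (Suc n) i) = len (gj_row C n i)"
proof -
  let ?x = "gj_row C n i" and ?G = "gj_row C (Suc n) n"
  have step: "gj_row C (Suc n) i = (if ?G \<noteq> 0 then ?x - lookup ?x (piv ?G) *\<^sub>f ?G else ?x)"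
    using assms(2) by (simp add: gj_row.simps(2)[of C n i] Let_def)
  have "lookup ?G (piv ?x) = 0" if "?x \<noteq> 0"
    using elimination_clears_pivots[OF assms(1), of n i] that assms(2)
    by (simp add: gj_row.simps(2)[of C n n] Let_def)
  then show ?thesis
    by (cases "?x = 0") (auto simp: step jordan_step_keeps_len)
qed

lemma len_fscale: "c \<noteq> 0 \<Longrightarrow> len (c *\<^sub>f x) = len x"
  by (simp add: len_def keys_def)

text \<open>
  Stage \<open>n\<close> creates one new pivot column, which Jordan elimination clears in the old rows, and it
  leaves the old pivot columns alone because the new row vanishes there.
\<close>

lemma reduced_gj_row: "reduced n (gj_row C n)"
proof (induction n)
  case 0
  then show ?case by (simp add: reduced_def)
next
  case (Suc n)
  note red = Suc.IH
  let ?R = "gj_row C n" and ?R' = "gj_row C (Suc n)" and ?x = "gj_row C n n"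
  let ?G = "gj_row C (Suc n) n"
  have G: "?G = (if ?x \<noteq> 0 then inverse (lookup ?x (piv ?x)) *\<^sub>f ?x else 0)"
    by (simp add: gj_row.simps(2)[of C n n] Let_def)
  have G_clear: "lookup ?G (piv (?R i)) = 0" if "i < n" "?R i \<noteq> 0" for i
    using elimination_clears_pivots[OF red, of n i] that by (simp add: G)
  have G_lead: "lookup ?G (piv ?G) = 1" if "?G \<noteq> 0"
    using that lookup_piv_nonzero[of ?x] by (auto simp: G len_fscale split: if_splits)
  have step: "?R' i = (if ?G \<noteq> 0 then ?R i - lookup (?R i) (piv ?G) *\<^sub>f ?G else ?R i)"
    if "i < n" for i
    using that by (simp add: gj_row.simps(2)[of C n i] Let_def)
  show ?case
    unfolding reduced_def
  proof (intro allI impI)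
    fix i j
    assume i: "i < Suc n" and nz: "?R' i \<noteq> 0" and j: "j < Suc n"
    show "lookup (?R' j) (piv (?R' i)) = (if j = i then 1 else 0)"
    proof (cases "i = n")
      case True
      then show ?thesis
        using nz j G_lead by (cases "j = n") (auto simp: step lookup_minus)
    next
      case False
      then have "i < n"
        using i by simp
      note len = stage_keeps_len[OF red this]
      have "?R i \<noteq> 0"
        using nz len_eq_imp_zero_iff[OF len] by simp
      then show ?thesis
        using \<open>i < n\<close> j G_clear[of i] reducedD[OF red, of i j] len
        by (cases "j = n") (auto simp: step[of j] lookup_minus)
    qed
  qed
qed

lemma len_gj_row_eq_gauss_mat:
  assumes "i < n"
  shows "len (gj_row C n i) = len (gauss_mat C i)"
  using Suc_leI[OF assms]
proof (induction n rule: dec_induct)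
  case base
  then show ?case by (simp add: gauss_mat_def)
next
  case (step n)
  then show ?case
    using stage_keeps_len[OF reduced_gj_row, of i n C] by simp
qed

text \<open>
  The rows are compared at the end of stage \<open>n\<close>, where the later row has just been normalized and
  the earlier one still has the length of its normalized form.
\<close>

lemma gauss_mat_distinct_lengths: "inj_on (\<lambda>n. len (gauss_mat C n)) {n. gauss_mat C n \<noteq> 0}"
proof (rule linorder_inj_onI')
  fix i n assume nz: "i \<in> {n. gauss_mat C n \<noteq> 0}" "n \<in> {n. gauss_mat C n \<noteq> 0}" and "i < n"
  let ?p = "gj_row C (Suc n) i"
  have len: "len ?p = len (gauss_mat C i)"
    using \<open>i < n\<close> by (simp add: len_gj_row_eq_gauss_mat)
  then have "?p \<noteq> 0"
    using nz(1) len_eq_imp_zero_iff[OF len] by simp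
  then have "lookup (gauss_mat C n) (piv ?p) = 0"
    using reducedD[OF reduced_gj_row, of i "Suc n" n C] \<open>i < n\<close> by (simp add: gauss_mat_def)
  then show "len (gauss_mat C i) \<noteq> len (gauss_mat C n)"
    using lookup_piv_nonzero[of "gauss_mat C n"] nz(2) len by auto
qed

section \<open>Bases of the row space and of the kernel\<close>

lemma complete_length_basis_nonzero_rows:
  assumes inj: "inj_on (\<lambda>n. len (A n)) {n. A n \<noteq> 0}"
  shows "complete_length_basis (A ` {n. A n \<noteq> 0}) (row_space A)"
proof -
  let ?B = "A ` {n. A n \<noteq> 0}"
  have nz: "0 \<notin> ?B"
    by auto
  have inj_len: "inj_on len ?B"
    using inj by (auto simp: inj_on_def)
  have span: "fsv.span ?B = row_space A"
  proof -
    have "?B - {0} = range A - {0}"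
      by auto
    then show ?thesis
      unfolding row_space_def by (metis fsv.span_delete_0)
  qed
  show ?thesis
    unfolding complete_length_basis_def hamel_basis_def span[symmetric]
    using independent_if_distinct_lengths[OF nz inj_len]
      lengths_span_distinct_lengths[OF nz inj_len]
    by (intro conjI) (rule refl | erule sym | assumption)+
qed

lemma kernel_eq_span_comp_seq:
  "fseq_kernel (\<lambda>x. x v* C) = fsv.span (comp_seq C ` {n. gauss_mat C n = 0})"
  unfolding span_image_eq_vec_mat
proof (intro equalityI subsetI)
  fix x assume "x \<in> fseq_kernel (\<lambda>x. x v* C)"
  then have x: "x v* C = 0"
    by (simp add: fseq_kernel_def)
  obtain Q where Q: "Q m* comp_seq C = mat_id"
    by (rule comp_seq_invertible)
  then have eq: "x = (x v* Q) v* comp_seq C"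
    by (simp add: vec_mat_assoc)
  then have "(x v* Q) v* gauss_mat C = 0"
    using x by (metis comp_seq_mult vec_mat_assoc)
  then have "keys (x v* Q) \<subseteq> {n. gauss_mat C n = 0}"
    by (rule vec_mat_eq_0_distinct_lengths[OF gauss_mat_distinct_lengths])
  then show "x \<in> {y v* comp_seq C |y. keys y \<subseteq> {n. gauss_mat C n = 0}}"
    using eq by blast
next
  fix x assume "x \<in> {y v* comp_seq C |y. keys y \<subseteq> {n. gauss_mat C n = 0}}"
  then obtain y where y: "x = y v* comp_seq C" "keys y \<subseteq> {n. gauss_mat C n = 0}"
    by blast
  have "x v* C = y v* gauss_mat C"
    by (simp add: y(1) vec_mat_assoc comp_seq_mult)
  also have "\<dots> = 0"
    unfolding vec_mat_def using y(2) by (intro sum.neutral) auto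
  finally show "x \<in> fseq_kernel (\<lambda>x. x v* C)"
    by (simp add: fseq_kernel_def)
qed

lemma gauss_mat_row_equiv: "gauss_mat C \<sim>\<^sub>r C"
proof -
  obtain Q where Q: "Q m* comp_seq C = mat_id" "comp_seq C m* Q = mat_id"
    by (rule comp_seq_invertible)
  then have "Q m* gauss_mat C = C"
    by (simp flip: comp_seq_mult mat_mult_assoc)
  then show ?thesis
    unfolding row_equiv_def using Q by blast
qed

lemma row_space_mult_subset: "row_space (A m* B) \<subseteq> row_space B"
  by (auto simp: row_space_eq_range simp flip: vec_mat_assoc)

lemma row_equiv_imp_row_space_eq:
  assumes "A \<sim>\<^sub>r B"
  shows "row_space A = row_space B"
proof -
  obtain Q Q' where Q: "Q' m* Q = mat_id" "Q m* A = B"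
    using assms by (auto simp: row_equiv_def)
  then have "Q' m* B = A"
    by (metis mat_mult_assoc mat_id_mult)
  then show ?thesis
    using row_space_mult_subset[of Q A] row_space_mult_subset[of Q' B] Q(2) by auto
qed

theorem proposition36:
  fixes C :: "'a::field rfmat"
    and f :: "'a fseq \<Rightarrow> 'a fseq"
    and G :: "'a rfmat"
    and g :: "nat \<Rightarrow> 'a fseq"
    and J W :: "nat set"
  defines "f \<equiv> (\<lambda>\<xi>. \<xi> v* C)"
    and "G \<equiv> gauss_mat C"
    and "g \<equiv> comp_seq C"
    and "J \<equiv> {n. G n \<noteq> 0}"
    and "W \<equiv> {n. G n = 0}"
  shows "(inj g \<and> hamel_basis (range g) UNIV)
      \<and> (G \<sim>\<^sub>r C)
      \<and> (row_space G = row_space C)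
      \<and> (inj_on G J \<and> complete_length_basis (G ` J) (row_space C))
      \<and> (inj_on g W \<and> hamel_basis (g ` W) (fseq_kernel f))"
proof (intro conjI)
  show "inj g" and "hamel_basis (range g) UNIV"
    unfolding g_def by (rule inj_comp_seq, rule hamel_basis_comp_seq)
  show equiv: "G \<sim>\<^sub>r C"
    unfolding G_def by (rule gauss_mat_row_equiv)
  show space: "row_space G = row_space C"
    using equiv by (rule row_equiv_imp_row_space_eq)
  show "inj_on G J"
    using gauss_mat_distinct_lengths[of C] by (auto simp: G_def J_def inj_on_def)
  show "complete_length_basis (G ` J) (row_space C)"
    using complete_length_basis_nonzero_rows[OF gauss_mat_distinct_lengths[of C]] space
    by (simp add: G_def J_def)
  show "inj_on g W"
    using \<open>inj g\<close> by (rule inj_on_subset) simp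
  have "fsv.independent (g ` W)"
    using \<open>hamel_basis (range g) UNIV\<close>
    using fsv.independent_mono[of "range g" "g ` W"] by (auto simp: hamel_basis_def)
  then show "hamel_basis (g ` W) (fseq_kernel f)"
    by (simp add: hamel_basis_def f_def g_def W_def G_def kernel_eq_span_comp_seq)
qed

end
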